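(* Suppose $\Omega \subset \mathbb{C}^d$ is a Goldilocks domain and $\lambda \geq 1$, $\kappa \geq 0$. If $\xi,\eta \in \partial\Omega$ and $V_\xi, V_\eta$ are neighborhoods of $\xi,\eta$ (respectively) in $\overline{\Omega}$ such that $\overline{V_\xi} \cap \overline{V_\eta} = \emptyset$, then there exists a compact set $K \subset \Omega$ with the following property: if $\sigma: [0,T] \rightarrow \Omega$ is a $(\lambda, \kappa)$-almost-geodesic with $\sigma(0) \in V_\xi$ and $\sigma(T) \in V_\eta$, then $\sigma([0,T]) \cap K \neq \emptyset$.
   Context: For a bounded domain $\Omega \subset \mathbb{C}^d$: $K_\Omega$ is the Kobayashi distance on $\Omega$; $k_\Omega(x;v)$ ($x\in\Omega$, $v\in\mathbb{C}^d$) is the infinitesimal Kobayashi (Kobayashi--Royden) metric (normalised so that on the unit disc $\Delta\subset\mathbb{C}$ one has $k_\Delta(\zeta;1)=1/(1-|\zeta|^2)$ and $K_\Delta$ is the corresponding Poincaré distance); $\|\cdot\|$ is the Euclidean norm; $\delta_\Omega(x)$ is the Euclidean distance from $x$ to $\partial\Omega$. Define $$M_\Omega(r) := \sup\left\{ \frac{1}{k_{\Omega}(x;v)} : \delta_\Omega(x) \leq r, \|v\|=1\right\}.$$ A bounded domain $\Omega \subset \mathbb{C}^d$ is a Goldilocks domain if (1) for some (hence any) $\epsilon >0$, $\int_0^\epsilon \frac{1}{r} M_\Omega(r)\, dr < \infty$; and (2) for each $x_0 \in \Omega$ there exist constants $C, \alpha > 0$ (depending on $x_0$) such that $K_\Omega(x_0,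 x) \leq C + \alpha \log \frac{1}{\delta_\Omega(x)}$ for all $x \in \Omega$. For an interval $I\subset\mathbb{R}$, $\lambda\ge 1$, $\kappa\ge 0$, a curve $\sigma: I\to\Omega$ is a $(\lambda,\kappa)$-almost-geodesic if (i) $\frac{1}{\lambda}|t-s|-\kappa \le K_\Omega(\sigma(s),\sigma(t)) \le \lambda|t-s|+\kappa$ for all $s,t\in I$; and (ii) $\sigma$ is absolutely continuous (so $\sigma'(t)$ exists for almost every $t\in I$) and $k_\Omega(\sigma(t);\sigma'(t))\le\lambda$ for almost every $t\in I$. *)

theory Defs
  imports "HOL-Analysis.Analysis"
begin

text \<open>The type \<^typ>\<open>complex^'d\<close> plays the role of $\mathbb{C}^d$; its norm is the Euclidean norm.\<close>

definition bounded_domain :: "(complex^'d) set \<Rightarrow> bool" where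
  "bounded_domain \<Omega> \<longleftrightarrow> open \<Omega> \<and> connected \<Omega> \<and> \<Omega> \<noteq> {} \<and> bounded \<Omega>"

definition holomorphic_disc :: "(complex^'d) set \<Rightarrow> (complex \<Rightarrow> complex^'d) \<Rightarrow> bool" where
  "holomorphic_disc \<Omega> f \<longleftrightarrow>
     (\<forall>i. (\<lambda>z. f z $ i) holomorphic_on ball 0 1) \<and> f ` ball 0 1 \<subseteq> \<Omega>"

definition kobayashi_metric :: "(complex^'d) set \<Rightarrow> complex^'d \<Rightarrow> complex^'d \<Rightarrow> real" where
  "kobayashi_metric \<Omega> x v =
     Inf {cmod c | c f. holomorphic_disc \<Omega> f \<and> f 0 = x \<and> c *s (\<chi> i. deriv (\<lambda>z. f z $ i) 0) = v}"

text \<open>The Poincare distance of the unit disc for the metric $|dz|/(1-|z|^2)$.\<close>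

definition poincare_dist :: "complex \<Rightarrow> complex \<Rightarrow> real" where
  "poincare_dist a b = artanh (cmod ((a - b) / (1 - cnj b * a)))"

text \<open>Kobayashi's definition by chains of holomorphic discs: the \<open>j\<close>-th disc joins \<open>p j\<close> to
  \<open>p (Suc j)\<close>.\<close>

definition kobayashi_dist :: "(complex^'d) set \<Rightarrow> complex^'d \<Rightarrow> complex^'d \<Rightarrow> real" where
  "kobayashi_dist \<Omega> x y =
     Inf {\<Sum>j<n. poincare_dist (a j) (b j) | (n::nat) p f a b.
            p 0 = x \<and> p n = y \<and>
            (\<forall>j<n. holomorphic_disc \<Omega> (f j) \<and> a j \<in> ball 0 1 \<and> b j \<in> ball 0 1 \<and>
                    f j (a j) = p j \<and> f j (b j) = p (Suc j))}"

definition bdry_dist :: "(complex^'d) set \<Rightarrow> complex^'d \<Rightarrow> real" where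
  "bdry_dist \<Omega> x = infdist x (frontier \<Omega>)"

text \<open>For a bounded domain, $k_\Omega(x;v)$ is bounded below by a positive multiple of $\|v\|$, so that
  for \<open>r > 0\<close> this is the supremum of a nonempty bounded set of positive reals.\<close>

definition goldilocks_M :: "(complex^'d) set \<Rightarrow> real \<Rightarrow> real" where
  "goldilocks_M \<Omega> r =
     Sup {1 / kobayashi_metric \<Omega> x v | x v. x \<in> \<Omega> \<and> bdry_dist \<Omega> x \<le> r \<and> norm v = 1}"

definition goldilocks_domain :: "(complex^'d) set \<Rightarrow> bool" where
  "goldilocks_domain \<Omega> \<longleftrightarrow>
     bounded_domain \<Omega> \<and>
     (\<exists>\<epsilon>>0. (\<integral>\<^sup>+ r\<in>{0<..<\<epsilon>}. ennreal (1 / r * goldilocks_M \<Omega> r) \<partial>lborel) < \<infinity>) \<and>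
     (\<forall>x0\<in>\<Omega>. \<exists>C>0. \<exists>\<alpha>>0. \<forall>x\<in>\<Omega>.
        kobayashi_dist \<Omega> x0 x \<le> C + \<alpha> * ln (1 / bdry_dist \<Omega> x))"

definition absolutely_continuous_on :: "real set \<Rightarrow> (real \<Rightarrow> 'a::metric_space) \<Rightarrow> bool" where
  "absolutely_continuous_on I \<sigma> \<longleftrightarrow>
     (\<forall>\<epsilon>>0. \<exists>\<delta>>0. \<forall>(n::nat) a b.
        (\<forall>j<n. a j \<in> I \<and> b j \<in> I \<and> a j \<le> b j) \<and>
        (\<forall>i<n. \<forall>j<n. i \<noteq> j \<longrightarrow> {a i<..<b i} \<inter> {a j<..<b j} = {}) \<and>
        (\<Sum>j<n. b j - a j) < \<delta>
        \<longrightarrow> (\<Sum>j<n. dist (\<sigma> (a j)) (\<sigma> (b j))) < \<epsilon>)"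

text \<open>Absolute continuity already makes \<open>\<sigma>\<close> differentiable almost everywhere; the last clause
  quantifies over the derivative so as not to depend on the value of \<^const>\<open>vector_derivative\<close>
  where there is none.\<close>

definition almost_geodesic ::
    "(complex^'d) set \<Rightarrow> real \<Rightarrow> real \<Rightarrow> real set \<Rightarrow> (real \<Rightarrow> complex^'d) \<Rightarrow> bool" where
  "almost_geodesic \<Omega> \<Lambda> \<kappa> I \<sigma> \<longleftrightarrow>
     is_interval I \<and> \<sigma> ` I \<subseteq> \<Omega> \<and>
     (\<forall>s\<in>I. \<forall>t\<in>I. 1 / \<Lambda> * \<bar>t - s\<bar> - \<kappa> \<le> kobayashi_dist \<Omega> (\<sigma> s) (\<sigma> t) \<and>
                   kobayashi_dist \<Omega> (\<sigma> s) (\<sigma> t) \<le> \<Lambda> * \<bar>t - s\<bar> + \<kappa>) \<and>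
     absolutely_continuous_on I \<sigma> \<and>
     (AE t in lborel. t \<in> I \<longrightarrow>
        (\<exists>v. (\<sigma> has_vector_derivative v) (at t within I) \<and> kobayashi_metric \<Omega> (\<sigma> t) v \<le> \<Lambda>))"

text \<open>Neighbourhoods of \<open>x\<close> relative to \<open>S\<close>; they need not be open.\<close>

definition nbhd_within :: "'a::topological_space set \<Rightarrow> 'a \<Rightarrow> 'a set \<Rightarrow> bool" where
  "nbhd_within S x V \<longleftrightarrow> V \<subseteq> S \<and> (\<exists>U. openin (top_of_set S) U \<and> x \<in> U \<and> U \<subseteq> V)"

end

theory Submission
  imports Defs "HOL-Complex_Analysis.Cauchy_Integral_Formula"
begin

text \<open>Suppose an almost-geodesic stays within distance \<open>\<epsilon>\<close> of the boundary, and let \<open>t\<^sub>0\<close> be a time at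
  which its distance \<open>\<delta>\<close> to the boundary is largest. Going through a base point, the triangle
  inequality and the logarithmic growth of the Kobayashi distance give
  \<open>\<bar>t - t\<^sub>0\<bar> / \<Lambda> - \<kappa> \<le> 2 C + 2 \<alpha> ln (1 / \<delta> (\<sigma> t))\<close>, so \<open>\<delta> (\<sigma> t)\<close> decays exponentially in
  \<open>\<bar>t - t\<^sub>0\<bar>\<close>. The Euclidean speed is at most \<open>\<Lambda> M (\<delta> (\<sigma> t))\<close>, and after the substitution
  \<open>r = A exp (- B s)\<close> the Dini condition makes its integral over all times arbitrarily small as
  \<open>\<epsilon> \<rightarrow> 0\<close>, uniformly in the curve. Hence such a curve cannot join two sets at positive distance.\<close>

section \<open>Absolutely continuous curves\<close>

text \<open>A bijection with \<open>{..<card P}\<close> carries the definition over to families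
  indexed by any finite set, such as the tagged pairs of a division.\<close>

lemma absolutely_continuous_on_finite_family:
  assumes "absolutely_continuous_on S \<sigma>" and "0 < \<epsilon>"
  shows "\<exists>\<delta>>0. \<forall>(P::'b set) a b. finite P \<longrightarrow> (\<forall>p\<in>P. a p \<in> S \<and> b p \<in> S \<and> a p \<le> b p) \<longrightarrow>
           (\<forall>p\<in>P. \<forall>q\<in>P. p \<noteq> q \<longrightarrow> {a p<..<b p} \<inter> {a q<..<b q} = {}) \<longrightarrow>
           (\<Sum>p\<in>P. b p - a p) < \<delta> \<longrightarrow> (\<Sum>p\<in>P. dist (\<sigma> (a p)) (\<sigma> (b p))) < \<epsilon>"
proof -
  obtain \<delta> where "0 < \<delta>" and \<delta>: "\<And>(n::nat) a b.
        (\<forall>j<n. a j \<in> S \<and> b j \<in> S \<and> a j \<le> b j) \<and>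
        (\<forall>i<n. \<forall>j<n. i \<noteq> j \<longrightarrow> {a i<..<b i} \<inter> {a j<..<b j} = {}) \<and>
        (\<Sum>j<n. b j - a j) < \<delta>
        \<longrightarrow> (\<Sum>j<n. dist (\<sigma> (a j)) (\<sigma> (b j))) < \<epsilon>"
    using assms unfolding absolutely_continuous_on_def by blast
  show ?thesis
  proof (intro exI[of _ \<delta>] conjI allI impI \<open>0 < \<delta>\<close>)
    fix P :: "'b set" and a b
    assume fin: "finite P" and S: "\<forall>p\<in>P. a p \<in> S \<and> b p \<in> S \<and> a p \<le> b p"
      and disj: "\<forall>p\<in>P. \<forall>q\<in>P. p \<noteq> q \<longrightarrow> {a p<..<b p} \<inter> {a q<..<b q} = {}"
      and sm: "(\<Sum>p\<in>P. b p - a p) < \<delta>"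
    obtain h where h: "bij_betw h {..<card P} P"
      using ex_bij_betw_nat_finite[OF fin] by (metis atLeast0LessThan)
    have hP: "h j \<in> P" if "j < card P" for j
      using h that by (auto simp: bij_betw_def)
    have hinj: "h i \<noteq> h j" if "i < card P" "j < card P" "i \<noteq> j" for i j
      using h that by (auto simp: bij_betw_def inj_on_def)
    have "(\<Sum>j<card P. dist (\<sigma> (a (h j))) (\<sigma> (b (h j)))) < \<epsilon>"
      by (rule \<delta>[of "card P" "\<lambda>j. a (h j)" "\<lambda>j. b (h j)", THEN mp])
         (use S hP hinj disj sm sum.reindex_bij_betw[OF h, of "\<lambda>p. b p - a p"] in auto)
    then show "(\<Sum>p\<in>P. dist (\<sigma> (a p)) (\<sigma> (b p))) < \<epsilon>"
      using sum.reindex_bij_betw[OF h, of "\<lambda>p. dist (\<sigma> (a p)) (\<sigma> (b p))"] by simp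
  qed
qed

text \<open>Only the family consisting of one interval is needed; \<open>min\<close> and
  \<open>max\<close> put its endpoints in order.\<close>

lemma absolutely_continuous_on_imp_continuous_on:
  assumes "absolutely_continuous_on S \<sigma>"
  shows "continuous_on S \<sigma>"
proof (subst continuous_on_iff, intro ballI allI impI)
  fix x \<epsilon> :: real assume "x \<in> S" "0 < \<epsilon>"
  obtain \<delta> where "0 < \<delta>" and \<delta>: "\<forall>(P::unit set) a b. finite P \<longrightarrow> (\<forall>p\<in>P. a p \<in> S \<and> b p \<in> S \<and> a p \<le> b p) \<longrightarrow>
           (\<forall>p\<in>P. \<forall>q\<in>P. p \<noteq> q \<longrightarrow> {a p<..<b p} \<inter> {a q<..<b q} = {}) \<longrightarrow>
           (\<Sum>p\<in>P. b p - a p) < \<delta> \<longrightarrow> (\<Sum>p\<in>P. dist (\<sigma> (a p)) (\<sigma> (b p))) < \<epsilon>"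
    using absolutely_continuous_on_finite_family[OF assms \<open>0 < \<epsilon>\<close>] by blast
  show "\<exists>d>0. \<forall>x'\<in>S. dist x' x < d \<longrightarrow> dist (\<sigma> x') (\<sigma> x) < \<epsilon>"
  proof (intro exI conjI ballI impI)
    fix y assume "y \<in> S" "dist y x < \<delta>"
    then show "dist (\<sigma> y) (\<sigma> x) < \<epsilon>"
      using \<delta>[rule_format, of "{()}" "\<lambda>_. min x y" "\<lambda>_. max x y"] \<open>x \<in> S\<close>
      by (cases "x \<le> y") (auto simp: dist_real_def min_def max_def dist_commute)
  qed fact
qed

text \<open>The bad null set is covered by an open set so small that absolute continuity makes the
  intervals tagged in it negligible; on the others the derivative bound applies, and the gauge of
  the integral of \<open>h\<close> finishes the estimate.\<close>

lemma absolutely_continuous_on_dist_le_integral: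
  fixes \<sigma> :: "real \<Rightarrow> 'a::real_normed_vector"
  assumes ac: "absolutely_continuous_on {a..b} \<sigma>" and "a \<le> b"
    and deriv: "AE t in lborel. t \<in> {a..b} \<longrightarrow>
       (\<exists>v. (\<sigma> has_vector_derivative v) (at t within {a..b}) \<and> norm v \<le> h t)"
    and h: "(h has_integral I) {a..b}" and h0: "\<And>t. t \<in> {a..b} \<Longrightarrow> 0 \<le> h t"
  shows "dist (\<sigma> a) (\<sigma> b) \<le> I"
proof (rule field_le_epsilon)
  fix e :: real assume "0 < e"
  \<comment> \<open>\<open>c\<close> is the slack allowed in the derivative bound; over the whole
    interval it costs at most \<open>e / 3\<close>. The \<open>+ 1\<close> keeps the denominator
    positive when \<open>a = b\<close>.\<close>
  define c where "c = e / (3 * (b - a + 1))"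
  have "0 < c" using \<open>0 < e\<close> \<open>a \<le> b\<close> by (simp add: c_def)
  have cba: "c * (b - a) \<le> e / 3"
    using \<open>0 < e\<close> \<open>a \<le> b\<close> by (simp add: c_def field_simps)
  have "0 < e / 3" using \<open>0 < e\<close> by simp
  obtain \<delta> where "0 < \<delta>"
    and \<delta>: "\<forall>(P::(real \<times> real set) set) a' b'. finite P \<longrightarrow>
         (\<forall>p\<in>P. a' p \<in> {a..b} \<and> b' p \<in> {a..b} \<and> a' p \<le> b' p) \<longrightarrow>
         (\<forall>p\<in>P. \<forall>q\<in>P. p \<noteq> q \<longrightarrow> {a' p<..<b' p} \<inter> {a' q<..<b' q} = {}) \<longrightarrow>
         (\<Sum>p\<in>P. b' p - a' p) < \<delta> \<longrightarrow> (\<Sum>p\<in>P. dist (\<sigma> (a' p)) (\<sigma> (b' p))) < e / 3"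
    using absolutely_continuous_on_finite_family[OF ac \<open>0 < e / 3\<close>] by blast
  obtain N where N: "{t \<in> space lborel. \<not> (t \<in> {a..b} \<longrightarrow>
       (\<exists>v. (\<sigma> has_vector_derivative v) (at t within {a..b}) \<and> norm v \<le> h t))} \<subseteq> N"
      "emeasure lborel N = 0" "N \<in> sets lborel"
    using AE_E[OF deriv] by blast
  obtain U where U: "open U" "N \<subseteq> U" "emeasure lborel (U - N) < \<delta>"
    using outer_regular_lborel[of N \<delta>] N \<open>0 < \<delta>\<close> by auto
  have "emeasure lborel U \<le> emeasure lborel (U - N) + emeasure lborel N"
    using emeasure_subadditive[of "U - N" lborel N] U N by (auto simp: Un_absorb2)
  then have U\<delta>: "emeasure lborel U < ennreal \<delta>"
    using U(3) N(2) by auto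
  \<comment> \<open>Differentiability becomes a Lipschitz estimate centred at \<open>t\<close>. At
    bad points the claim is vacuous, so that \<open>d\<close> is total and can serve in a
    gauge.\<close>
  have "\<exists>d>0. t \<in> {a..b} - N \<longrightarrow>
      (\<forall>y\<in>{a..b}. \<bar>y - t\<bar> < d \<longrightarrow> norm (\<sigma> y - \<sigma> t) \<le> (h t + c) * \<bar>y - t\<bar>)" for t
  proof (cases "t \<in> {a..b} - N")
    case True
    then obtain v where "(\<sigma> has_vector_derivative v) (at t within {a..b})" "norm v \<le> h t"
      using N(1) by auto
    then obtain d where "d > 0" and d: "\<And>y. y \<in> {a..b} \<Longrightarrow> norm (y - t) < d \<Longrightarrow>
        norm (\<sigma> y - \<sigma> t - (y - t) *\<^sub>R v) \<le> c * norm (y - t)"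
      using \<open>0 < c\<close> unfolding has_vector_derivative_def has_derivative_within_alt by meson
    have "norm (\<sigma> y - \<sigma> t) \<le> (h t + c) * \<bar>y - t\<bar>" if "y \<in> {a..b}" "\<bar>y - t\<bar> < d" for y
    proof -
      have "norm (\<sigma> y - \<sigma> t) \<le> norm (\<sigma> y - \<sigma> t - (y - t) *\<^sub>R v) + norm ((y - t) *\<^sub>R v)"
        by (metis diff_add_cancel norm_triangle_ineq)
      also have "\<dots> \<le> c * \<bar>y - t\<bar> + \<bar>y - t\<bar> * h t"
        using d[of y] that \<open>norm v \<le> h t\<close> by (intro add_mono) (auto intro: mult_left_mono)
      finally show ?thesis by (simp add: algebra_simps)
    qed
    then show ?thesis using \<open>d > 0\<close> by blast
  qed (auto intro: exI[of _ 1])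
  then obtain d where dpos: "\<And>t. 0 < d t" and d: "\<And>t y. t \<in> {a..b} - N \<Longrightarrow> y \<in> {a..b} \<Longrightarrow>
      \<bar>y - t\<bar> < d t \<Longrightarrow> norm (\<sigma> y - \<sigma> t) \<le> (h t + c) * \<bar>y - t\<bar>"
    by metis
  obtain \<gamma> where "gauge \<gamma>" and \<gamma>: "\<And>p. p tagged_division_of {a..b} \<Longrightarrow> \<gamma> fine p \<Longrightarrow>
      norm ((\<Sum>(x, K)\<in>p. measure lborel K *\<^sub>R h x) - I) < e / 3"
    using h \<open>0 < e / 3\<close> unfolding has_integral_real by meson
  \<comment> \<open>A cell tagged in \<open>N\<close> is forced into \<open>U\<close>; any other
    cell lies within reach of the estimate at its tag.\<close>
  define \<gamma>' where "\<gamma>' t = (if t \<in> N then U else ball t (d t))" for t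
  have "gauge \<gamma>'"
    unfolding gauge_def \<gamma>'_def using U dpos by auto
  then obtain p where p: "p tagged_division_of {a..b}" and "(\<lambda>x. \<gamma> x \<inter> \<gamma>' x) fine p"
    using fine_division_exists_real[OF gauge_Int[OF \<open>gauge \<gamma>\<close>]] by blast
  then have fine: "\<gamma> fine p" "\<gamma>' fine p"
    by (auto simp: fine_Int)
  have pD: "Inf K \<le> x \<and> x \<le> Sup K \<and> K = {Inf K..Sup K} \<and> Inf K \<in> {a..b} \<and> Sup K \<in> {a..b} \<and>
      x \<in> {a..b} \<and> Inf K \<in> K \<and> Sup K \<in> K \<and> measure lborel K = Sup K - Inf K" if xK: "(x, K) \<in> p" for x K
  proof -
    obtain u v where K: "K = {u..v}"
      using tagged_division_ofD(4)[OF p xK] by (auto simp: box_real)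
    have "x \<in> K" "K \<subseteq> {a..b}"
      using tagged_division_ofD(2,3)[OF p xK] by auto
    then show ?thesis unfolding K by auto
  qed
  have finp: "finite p" using p by auto
  define Q where "Q = {xK \<in> p. fst xK \<in> N}"
  have finQ: "finite Q" using finp by (simp add: Q_def)
  have QD: "Inf K \<le> Sup K \<and> K = {Inf K..Sup K} \<and> Inf K \<in> {a..b} \<and> Sup K \<in> {a..b} \<and> K \<subseteq> U"
    if "(x, K) \<in> Q" for x K
    using pD[of x K] fineD[OF fine(2), of x K] that by (auto simp: Q_def \<gamma>'_def)
  \<comment> \<open>Cells of a division may share endpoints, so only their interiors are disjoint;
    the definition of absolute continuity asks for no more.\<close>
  let ?G = "\<lambda>xK::real \<times> real set. {Inf (snd xK)<..<Sup (snd xK)}"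
  have GQ: "?G xK \<subseteq> U" "Inf (snd xK) \<le> Sup (snd xK)"
    "Inf (snd xK) \<in> {a..b}" "Sup (snd xK) \<in> {a..b}" if "xK \<in> Q" for xK
    using QD[of "fst xK" "snd xK"] that greaterThanLessThan_subseteq_atLeastAtMost_iff by fastforce+
  have disj: "?G xK \<inter> ?G yL = {}" if "xK \<in> Q" "yL \<in> Q" "xK \<noteq> yL" for xK yL
  proof -
    have "interior (snd xK) \<inter> interior (snd yL) = {}"
      using that tagged_division_ofD(5)[OF p, of "fst xK" "snd xK" "fst yL" "snd yL"]
      by (simp add: Q_def)
    moreover have "interior (snd xK) = ?G xK" if "xK \<in> Q" for xK
      using QD[of "fst xK" "snd xK"] that by (metis interior_atLeastAtMost_real prod.collapse)
    ultimately show ?thesis using that by simp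
  qed
  have small: "(\<Sum>xK\<in>Q. Sup (snd xK) - Inf (snd xK)) < \<delta>"
  proof -
    have "ennreal (\<Sum>xK\<in>Q. Sup (snd xK) - Inf (snd xK)) = (\<Sum>xK\<in>Q. emeasure lborel (?G xK))"
      using GQ(2) by (subst sum_ennreal[symmetric]) auto
    also have "\<dots> = emeasure lborel (\<Union>xK\<in>Q. ?G xK)"
      using finQ disj by (intro sum_emeasure) (auto simp: disjoint_family_on_def)
    also have "\<dots> \<le> emeasure lborel U"
      using GQ(1) U(1) by (intro emeasure_mono) auto
    also have "\<dots> < ennreal \<delta>" by (rule U\<delta>)
    finally show ?thesis
      using \<open>0 < \<delta>\<close> ennreal_less_iff GQ(2) by (metis (no_types, lifting) diff_ge_0_iff_ge sum_nonneg)
  qed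
  let ?f = "\<lambda>xK. norm (\<sigma> (Sup (snd xK)) - \<sigma> (Inf (snd xK)))"
  have bad: "(\<Sum>xK\<in>Q. ?f xK) < e / 3"
    using \<delta>[rule_format, of Q "\<lambda>xK. Inf (snd xK)" "\<lambda>xK. Sup (snd xK)"] finQ GQ disj small
    by (auto simp: dist_norm norm_minus_commute)
  \<comment> \<open>The increment over a cell is split at its tag. As the tag lies between the
    endpoints, its two distances to them add up to the length of the cell.\<close>
  have good: "?f xK \<le> (h (fst xK) + c) * measure lborel (snd xK)" if "xK \<in> p - Q" for xK
  proof -
    obtain x K where xK: "xK = (x, K)" by (cases xK)
    have *: "(x, K) \<in> p" "x \<notin> N" using that by (auto simp: Q_def xK)
    note D = pD[OF *(1)]
    have "K \<subseteq> ball x (d x)"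
      using fineD[OF fine(2) *(1)] *(2) by (simp add: \<gamma>'_def)
    then have "\<bar>Sup K - x\<bar> < d x" "\<bar>Inf K - x\<bar> < d x"
      using D by (auto simp: dist_real_def abs_minus_commute)
    then have "norm (\<sigma> (Sup K) - \<sigma> x) \<le> (h x + c) * \<bar>Sup K - x\<bar>"
      "norm (\<sigma> (Inf K) - \<sigma> x) \<le> (h x + c) * \<bar>Inf K - x\<bar>"
      using d[of x "Sup K"] d[of x "Inf K"] D *(2) by blast+
    then have "norm (\<sigma> (Sup K) - \<sigma> (Inf K)) \<le> (h x + c) * \<bar>Sup K - x\<bar> + (h x + c) * \<bar>Inf K - x\<bar>"
      using norm_triangle_ineq4[of "\<sigma> (Sup K) - \<sigma> x" "\<sigma> (Inf K) - \<sigma> x"] by simp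
    also have "\<dots> = (h x + c) * measure lborel K"
    proof -
      have eqs: "\<bar>Sup K - x\<bar> = Sup K - x" "\<bar>Inf K - x\<bar> = x - Inf K" "measure lborel K = Sup K - Inf K"
        using D by auto
      show ?thesis unfolding eqs by (simp add: algebra_simps)
    qed
    finally show ?thesis by (simp add: xK)
  qed
  \<comment> \<open>The increments over the cells telescope to the increment over
    \<open>{a..b}\<close>.\<close>
  have "dist (\<sigma> a) (\<sigma> b) = norm (\<Sum>xK\<in>p. \<sigma> (Sup (snd xK)) - \<sigma> (Inf (snd xK)))"
    using additive_tagged_division_1[OF \<open>a \<le> b\<close> p, of \<sigma>]
    by (simp add: dist_norm norm_minus_commute split_def)
  also have "\<dots> \<le> (\<Sum>xK\<in>p. ?f xK)"
    by (rule norm_sum)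
  also have "\<dots> = (\<Sum>xK\<in>p - Q. ?f xK) + (\<Sum>xK\<in>Q. ?f xK)"
    using finp by (intro sum.subset_diff) (auto simp: Q_def)
  also have "\<dots> \<le> (\<Sum>xK\<in>p - Q. (h (fst xK) + c) * measure lborel (snd xK)) + e / 3"
    using bad good by (intro add_mono sum_mono) auto
  also have "(\<Sum>xK\<in>p - Q. (h (fst xK) + c) * measure lborel (snd xK))
      \<le> (\<Sum>xK\<in>p. (h (fst xK) + c) * measure lborel (snd xK))"
    using finp pD h0 \<open>0 < c\<close> by (intro sum_mono2) (auto simp: less_imp_le intro!: mult_nonneg_nonneg add_nonneg_nonneg)
  also have "\<dots> = (\<Sum>(x, K)\<in>p. measure lborel K *\<^sub>R h x) + c * (b - a)"
  proof -
    have "(\<Sum>xK\<in>p. measure lborel (snd xK)) = b - a"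
      using additive_content_tagged_division[of p a b] p \<open>a \<le> b\<close> by (simp add: split_def)
    then show ?thesis
      by (simp add: split_def distrib_left sum.distrib mult.commute flip: sum_distrib_left)
  qed
  also have "(\<Sum>(x, K)\<in>p. measure lborel K *\<^sub>R h x) \<le> I + e / 3"
    using \<gamma>[OF p fine(1)] by (simp add: abs_if split: if_splits)
  also have "I + e / 3 + c * (b - a) + e / 3 \<le> I + e"
    using cba by linarith
  finally show "dist (\<sigma> a) (\<sigma> b) \<le> I + e" by simp
qed

section \<open>The Kobayashi distance as a pseudometric\<close>

lemma poincare_dist_commute: "poincare_dist a b = poincare_dist b a"
proof -
  have "1 - cnj b * a = cnj (1 - cnj a * b)" by simp
  then have "cmod (1 - cnj b * a) = cmod (1 - cnj a * b)" by (metis complex_mod_cnj)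
  then show ?thesis
    by (simp add: poincare_dist_def norm_divide norm_minus_commute)
qed

text \<open>The argument of \<open>artanh\<close> lies in \<open>[0, 1)\<close>, because
  \<open>(1 - |a|^2) * (1 - |b|^2)\<close> is the difference of the squared moduli of denominator
  and numerator.\<close>

lemma poincare_dist_nonneg:
  assumes "a \<in> ball 0 1" "b \<in> ball 0 1"
  shows "0 \<le> poincare_dist a b"
proof -
  have a: "cmod a < 1" and b: "cmod b < 1" using assms by auto
  have "cmod (cnj b * a) < 1"
    using a b by (metis complex_mod_cnj mult_strict_mono' norm_mult norm_ge_zero mult_1)
  then have "1 - cnj b * a \<noteq> 0" by auto
  have "0 < (1 - (cmod a)\<^sup>2) * (1 - (cmod b)\<^sup>2)"
    using a b by (intro mult_pos_pos) (simp_all add: power_less_one_iff abs_square_less_1)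
  also have "\<dots> = (cmod (1 - cnj b * a))\<^sup>2 - (cmod (a - b))\<^sup>2"
    unfolding cmod_power2 by (simp add: algebra_simps power2_eq_square)
  finally have "cmod (a - b) < cmod (1 - cnj b * a)"
    using power2_less_imp_less norm_ge_zero by fastforce
  then have "cmod ((a - b) / (1 - cnj b * a)) < 1"
    using \<open>1 - cnj b * a \<noteq> 0\<close> by (simp add: norm_divide)
  moreover have "0 \<le> artanh x" if "0 \<le> x" "x < 1" for x :: real
    using that by (simp add: artanh_def)
  ultimately show ?thesis by (simp add: poincare_dist_def)
qed

text \<open>The parameters \<open>a\<close> and \<open>b\<close> remain arguments since they alone
  determine the length of a chain; its points and discs are quantified away.\<close>

definition disc_chain ::
    "(complex^'d) set \<Rightarrow> complex^'d \<Rightarrow> complex^'d \<Rightarrow> nat \<Rightarrow> (nat \<Rightarrow> complex) \<Rightarrow> (nat \<Rightarrow> complex) \<Rightarrow> bool" where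
  "disc_chain \<Omega> x y n a b \<longleftrightarrow> (\<exists>p f. p 0 = x \<and> p n = y \<and>
     (\<forall>j<n. holomorphic_disc \<Omega> (f j) \<and> a j \<in> ball 0 1 \<and> b j \<in> ball 0 1 \<and>
            f j (a j) = p j \<and> f j (b j) = p (Suc j)))"

lemma disc_chain_append:
  assumes "disc_chain \<Omega> x y n a b" and "disc_chain \<Omega> y z m a' b'"
  shows "disc_chain \<Omega> x z (n + m) (\<lambda>j. if j < n then a j else a' (j - n))
           (\<lambda>j. if j < n then b j else b' (j - n))"
proof -
  obtain p f where p: "p 0 = x" "p n = y" "\<And>j. j < n \<Longrightarrow> holomorphic_disc \<Omega> (f j) \<and>
      a j \<in> ball 0 1 \<and> b j \<in> ball 0 1 \<and> f j (a j) = p j \<and> f j (b j) = p (Suc j)"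
    using assms(1) unfolding disc_chain_def by blast
  obtain q g where q: "q 0 = y" "q m = z" "\<And>j. j < m \<Longrightarrow> holomorphic_disc \<Omega> (g j) \<and>
      a' j \<in> ball 0 1 \<and> b' j \<in> ball 0 1 \<and> g j (a' j) = q j \<and> g j (b' j) = q (Suc j)"
    using assms(2) unfolding disc_chain_def by blast
  define r where "r j = (if j \<le> n then p j else q (j - n))" for j
  define h where "h j = (if j < n then f j else g (j - n))" for j
  \<comment> \<open>At the junction \<open>j = n\<close> both branches give \<open>y\<close>, so the
    last disc of the first chain and the first disc of the second one fit together.\<close>
  have r: "r j = q (j - n)" if "n \<le> j" for j using that p(2) q(1) by (auto simp: r_def)
  show ?thesis
    unfolding disc_chain_def
  proof (intro exI[of _ r] exI[of _ h] conjI allI impI)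
    show "r 0 = x" by (simp add: r_def p)
    show "r (n + m) = z" using r[of "n + m"] q by simp
  next
    fix j assume j: "j < n + m"
    show "holomorphic_disc \<Omega> (h j)"
      using p(3)[of j] q(3)[of "j - n"] j by (cases "j < n") (auto simp: h_def)
    show "(if j < n then a j else a' (j - n)) \<in> ball 0 1"
      using p(3)[of j] q(3)[of "j - n"] j by (cases "j < n") (auto simp: h_def)
    show "(if j < n then b j else b' (j - n)) \<in> ball 0 1"
      using p(3)[of j] q(3)[of "j - n"] j by (cases "j < n") (auto simp: h_def)
    show "h j (if j < n then a j else a' (j - n)) = r j"
      using p(3)[of j] q(3)[of "j - n"] j r[of j] by (cases "j < n") (auto simp: h_def r_def)
    show "h j (if j < n then b j else b' (j - n)) = r (Suc j)"
      using p(3)[of j] q(3)[of "j - n"] j r[of "Suc j"]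
      by (cases "j < n") (auto simp: h_def r_def Suc_diff_le)
  qed
qed

text \<open>Traversed backwards, the chain uses the same discs in the opposite order, with the two
  parameters of each exchanged.\<close>

lemma disc_chain_rev:
  assumes "disc_chain \<Omega> x y n a b"
  shows "disc_chain \<Omega> y x n (\<lambda>j. b (n - Suc j)) (\<lambda>j. a (n - Suc j))"
proof -
  obtain p f where p: "p 0 = x" "p n = y" "\<And>j. j < n \<Longrightarrow> holomorphic_disc \<Omega> (f j) \<and>
      a j \<in> ball 0 1 \<and> b j \<in> ball 0 1 \<and> f j (a j) = p j \<and> f j (b j) = p (Suc j)"
    using assms unfolding disc_chain_def by blast
  show ?thesis
    unfolding disc_chain_def
    by (intro exI[of _ "\<lambda>j. p (n - j)"] exI[of _ "\<lambda>j. f (n - Suc j)"])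
       (use p in \<open>auto simp: Suc_diff_Suc\<close>)
qed

definition chain_lengths :: "(complex^'d) set \<Rightarrow> complex^'d \<Rightarrow> complex^'d \<Rightarrow> real set" where
  "chain_lengths \<Omega> x y = {\<Sum>j<n. poincare_dist (a j) (b j) | n a b. disc_chain \<Omega> x y n a b}"

lemma chain_lengthsI:
  "disc_chain \<Omega> x y n a b \<Longrightarrow> (\<Sum>j<n. poincare_dist (a j) (b j)) \<in> chain_lengths \<Omega> x y"
  unfolding chain_lengths_def by auto

lemma kobayashi_dist_eq: "kobayashi_dist \<Omega> x y = Inf (chain_lengths \<Omega> x y)"
  unfolding kobayashi_dist_def chain_lengths_def disc_chain_def
  by (intro arg_cong[where f = Inf] Collect_cong iffI; elim exE conjE; intro exI conjI; assumption)

lemma chain_lengths_nonneg: "l \<in> chain_lengths \<Omega> x y \<Longrightarrow> 0 \<le> l"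
  unfolding chain_lengths_def disc_chain_def
  by (auto intro!: sum_nonneg poincare_dist_nonneg)

lemma bdd_below_chain_lengths: "bdd_below (chain_lengths \<Omega> x y)"
  using chain_lengths_nonneg by (metis bdd_belowI)

text \<open>This is the triangle inequality before infima are taken: lengths add under
  concatenation.\<close>

lemma chain_lengths_add:
  assumes "l \<in> chain_lengths \<Omega> x y" "l' \<in> chain_lengths \<Omega> y z"
  shows "l + l' \<in> chain_lengths \<Omega> x z"
proof -
  obtain n a b where 1: "disc_chain \<Omega> x y n a b" "l = (\<Sum>j<n. poincare_dist (a j) (b j))"
    using assms(1) by (auto simp: chain_lengths_def)
  obtain m a' b' where 2: "disc_chain \<Omega> y z m a' b'" "l' = (\<Sum>j<m. poincare_dist (a' j) (b' j))"
    using assms(2) by (auto simp: chain_lengths_def)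
  let ?a = "\<lambda>j. if j < n then a j else a' (j - n)" and ?b = "\<lambda>j. if j < n then b j else b' (j - n)"
  have "(\<Sum>j<n + m. g j) = (\<Sum>j<n. g j) + (\<Sum>j<m. g (n + j))" for g :: "nat \<Rightarrow> real"
    by (induction m) auto
  then have "l + l' = (\<Sum>j<n + m. poincare_dist (?a j) (?b j))"
    using 1(2) 2(2) by simp
  then show ?thesis
    using chain_lengthsI[OF disc_chain_append[OF 1(1) 2(1)]] by simp
qed

lemma chain_lengths_commute: "chain_lengths \<Omega> x y = chain_lengths \<Omega> y x"
proof -
  have "l \<in> chain_lengths \<Omega> y x" if l: "l \<in> chain_lengths \<Omega> x y" for l x y
  proof -
    obtain n a b where 1: "disc_chain \<Omega> x y n a b" "l = (\<Sum>j<n. poincare_dist (a j) (b j))"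
      using l by (auto simp: chain_lengths_def)
    have "l = (\<Sum>j<n. poincare_dist (b (n - Suc j)) (a (n - Suc j)))"
      unfolding 1(2) by (subst sum.nat_diff_reindex[symmetric]) (simp add: poincare_dist_commute)
    then show ?thesis
      using chain_lengthsI[OF disc_chain_rev[OF 1(1)]] by simp
  qed
  then show ?thesis by blast
qed

lemma kobayashi_dist_commute: "kobayashi_dist \<Omega> x y = kobayashi_dist \<Omega> y x"
  by (metis kobayashi_dist_eq chain_lengths_commute)

section \<open>Affine discs and the existence of chains\<close>

lemma norm_vector_scalar_mult: "norm (c *s v) = cmod c * norm (v::complex^'d)"
  by (simp add: norm_vec_def norm_mult L2_set_right_distrib)

text \<open>These are the only discs constructed explicitly. They show that the sets whose infima
  define \<open>kobayashi_dist\<close> and \<open>kobayashi_metric\<close> are nonempty.\<close>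

lemma holomorphic_disc_affine:
  assumes "ball x r \<subseteq> \<Omega>" "0 < r" "norm v \<le> r"
  shows "holomorphic_disc \<Omega> (\<lambda>z. x + z *s v)"
  unfolding holomorphic_disc_def
proof (intro conjI allI)
  show "(\<lambda>z. (x + z *s v) $ i) holomorphic_on ball 0 1" for i
    by (auto intro!: holomorphic_intros)
  show "(\<lambda>z. x + z *s v) ` ball 0 1 \<subseteq> \<Omega>"
  proof (cases "v = 0")
    case False
    have "cmod z * norm v < r" if "cmod z < 1" for z
      using that assms(3) False by (smt (verit) mult_less_cancel_right1 zero_less_norm_iff mult_less_cancel_right)
    then show ?thesis using assms(1) by (auto simp: norm_vector_scalar_mult dist_norm subset_iff)
  next
    case True
    then show ?thesis using assms(1,2) by auto
  qed
qed

lemma disc_chain_ball: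
  assumes "ball x r \<subseteq> \<Omega>" "y \<in> ball x r"
  shows "chain_lengths \<Omega> x y \<noteq> {}"
proof -
  have "0 < r" using assms(2) by (smt (verit) mem_ball zero_le_dist)
  define t where "t = dist x y"
  have "t < r" "0 \<le> t" using assms(2) by (auto simp: t_def)
  \<comment> \<open>A radius strictly above \<open>dist x y\<close> and at most \<open>r\<close>:
    the affine disc of this radius stays in the ball and meets \<open>y\<close> at the interior
    parameter \<open>t / s\<close>.\<close>
  define s where "s = (t + r) / 2"
  have s: "0 < s" "t < s" "s \<le> r" using \<open>0 < r\<close> \<open>t < r\<close> \<open>0 \<le> t\<close> by (auto simp: s_def)
  define v where "v = (if y = x then 0 else complex_of_real (s / t) *s (y - x))"
  have nv: "norm v \<le> r"
  proof (cases "y = x")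
    case False
    then have "t \<noteq> 0" by (auto simp: t_def)
    have "norm v = \<bar>s / t\<bar> * norm (y - x)"
      using False by (simp only: v_def norm_vector_scalar_mult norm_of_real if_False)
    also have "norm (y - x) = t" by (simp add: t_def dist_norm norm_minus_commute)
    finally show ?thesis using s \<open>0 \<le> t\<close> \<open>t \<noteq> 0\<close> by simp
  qed (use \<open>0 < r\<close> in \<open>simp add: v_def\<close>)
  have v: "x + complex_of_real (t / s) *s v = y"
  proof (cases "y = x")
    case False
    then have "complex_of_real (t / s) * complex_of_real (s / t) = 1"
      using s by (auto simp: t_def)
    then show ?thesis
      using False by (simp only: v_def if_False vector_smult_assoc) simp
  qed (simp add: v_def)
  have "disc_chain \<Omega> x y 1 (\<lambda>_. 0) (\<lambda>_. complex_of_real (t / s))"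
    unfolding disc_chain_def
  proof (intro exI[of _ "\<lambda>j. if j = 0 then x else y"] exI[of _ "\<lambda>_ z. x + z *s v"] conjI allI impI)
    show "holomorphic_disc \<Omega> (\<lambda>z. x + z *s v)"
      using holomorphic_disc_affine[OF assms(1) \<open>0 < r\<close> nv] by simp
  qed (use v s \<open>0 \<le> t\<close> in \<open>simp_all del: of_real_divide\<close>)
  from chain_lengthsI[OF this] show ?thesis by auto
qed

text \<open>Any two points of a ball in \<Omega> are joined through its centre, so being reachable
  from \<open>x\<close> is a locally constant property and connectedness spreads it over
  \<Omega>.\<close>

lemma chain_lengths_nonempty:
  assumes "open \<Omega>" "connected \<Omega>" "x \<in> \<Omega>" "y \<in> \<Omega>"
  shows "chain_lengths \<Omega> x y \<noteq> {}"
proof (rule connected_induction_simple[where P = "\<lambda>y. chain_lengths \<Omega> x y \<noteq> {}"])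
  obtain r where "0 < r" "ball x r \<subseteq> \<Omega>"
    using assms(1,3) open_contains_ball by blast
  then show "chain_lengths \<Omega> x x \<noteq> {}"
    using disc_chain_ball[of x r \<Omega> x] by simp
next
  fix a assume a: "a \<in> \<Omega>"
  obtain r where r: "0 < r" "ball a r \<subseteq> \<Omega>"
    using a assms(1) open_contains_ball by blast
  have "chain_lengths \<Omega> x z \<noteq> {}"
    if u: "u \<in> ball a r" and z: "z \<in> ball a r" and xu: "chain_lengths \<Omega> x u \<noteq> {}" for u z
  proof -
    obtain l1 where l1: "l1 \<in> chain_lengths \<Omega> x u" using xu by blast
    obtain l2 where l2: "l2 \<in> chain_lengths \<Omega> u a"
      using disc_chain_ball[OF r(2) u] unfolding chain_lengths_commute[of \<Omega> a u] by blast
    obtain l3 where l3: "l3 \<in> chain_lengths \<Omega> a z"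
      using disc_chain_ball[OF r(2) z] by blast
    from chain_lengths_add[OF chain_lengths_add[OF l1 l2] l3] show ?thesis by blast
  qed
  moreover have "openin (top_of_set \<Omega>) (ball a r)"
    using r(2) assms(1) by (simp add: openin_open_eq)
  ultimately show "\<exists>T. openin (top_of_set \<Omega>) T \<and> a \<in> T \<and>
      (\<forall>x'\<in>T. \<forall>y\<in>T. chain_lengths \<Omega> x x' \<noteq> {} \<longrightarrow> chain_lengths \<Omega> x y \<noteq> {})"
    using centre_in_ball r(1) by blast
qed fact+

text \<open>The infimum is taken over one leg at a time. Both sets of lengths must be nonempty for
  this, which is where openness and connectedness enter.\<close>

lemma kobayashi_dist_triangle:
  assumes "open \<Omega>" "connected \<Omega>" "x \<in> \<Omega>" "y \<in> \<Omega>" "z \<in> \<Omega>"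
  shows "kobayashi_dist \<Omega> x z \<le> kobayashi_dist \<Omega> x y + kobayashi_dist \<Omega> y z"
proof -
  have "kobayashi_dist \<Omega> x z - l' \<le> kobayashi_dist \<Omega> x y" if l': "l' \<in> chain_lengths \<Omega> y z" for l'
    unfolding kobayashi_dist_eq[of \<Omega> x y]
  proof (rule cInf_greatest)
    show "chain_lengths \<Omega> x y \<noteq> {}" using chain_lengths_nonempty assms by blast
    show "kobayashi_dist \<Omega> x z - l' \<le> l" if "l \<in> chain_lengths \<Omega> x y" for l
      using cInf_lower[OF chain_lengths_add[OF that l'] bdd_below_chain_lengths] 
      by (simp add: kobayashi_dist_eq)
  qed
  then have "kobayashi_dist \<Omega> x z - kobayashi_dist \<Omega> x y \<le> l'" if "l' \<in> chain_lengths \<Omega> y z" for l'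
    using that by (simp add: algebra_simps)
  then have "kobayashi_dist \<Omega> x z - kobayashi_dist \<Omega> x y \<le> kobayashi_dist \<Omega> y z"
    unfolding kobayashi_dist_eq[of \<Omega> y z]
    using chain_lengths_nonempty[OF assms(1,2,4,5)] by (intro cInf_greatest) auto
  then show ?thesis by simp
qed

section \<open>The Kobayashi metric and the Goldilocks function\<close>

text \<open>Cauchy's inequality on the circle of radius \<open>1/2\<close> bounds each coordinate of
  the derivative by \<open>2 * R\<close>; the norm is at most the sum over the
  \<open>CARD('d)\<close> coordinates.\<close>

lemma holomorphic_disc_deriv_bound:
  fixes f :: "complex \<Rightarrow> complex^'d" and R :: real
  assumes "holomorphic_disc \<Omega> f" and R: "\<And>y. y \<in> \<Omega> \<Longrightarrow> norm y \<le> R"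
  shows "norm (\<chi> i. deriv (\<lambda>z. f z $ i) 0) \<le> CARD('d) * (2 * R)"
proof -
  have "cmod (deriv (\<lambda>z. f z $ i) 0) \<le> 2 * R" for i
  proof -
    have hol: "(\<lambda>z. f z $ i) holomorphic_on ball 0 1" and img: "f ` ball 0 1 \<subseteq> \<Omega>"
      using assms(1) by (auto simp: holomorphic_disc_def)
    have "cmod ((deriv ^^ 1) (\<lambda>z. f z $ i) 0) \<le> fact 1 * R / (1/2)^1"
    proof (rule Cauchy_inequality)
      show "(\<lambda>z. f z $ i) holomorphic_on ball 0 (1/2)"
        using hol by (rule holomorphic_on_subset) auto
      show "continuous_on (cball 0 (1/2)) (\<lambda>z. f z $ i)"
        using holomorphic_on_imp_continuous_on[OF hol] by (rule continuous_on_subset) auto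
      show "cmod (f x $ i) \<le> R" if "cmod (0 - x) = 1/2" for x
      proof -
        have "f x \<in> \<Omega>" using img that by auto
        then show ?thesis using R Finite_Cartesian_Product.norm_nth_le[of "f x" i] order_trans by blast
      qed
    qed simp
    then show ?thesis by simp
  qed
  then have "(\<Sum>i\<in>UNIV. cmod ((\<chi> i. deriv (\<lambda>z. f z $ i) 0) $ (i::'d))) \<le> (\<Sum>i\<in>(UNIV::'d set). 2 * R)"
    by (intro sum_mono) simp
  moreover have "norm (\<chi> i. deriv (\<lambda>z. f z $ i) 0) \<le> (\<Sum>i\<in>UNIV. cmod ((\<chi> i. deriv (\<lambda>z. f z $ i) 0) $ (i::'d)))"
    unfolding norm_vec_def by (rule L2_set_le_sum) simp
  ultimately show ?thesis by simp
qed

definition tangent_disc_sizes :: "(complex^'d) set \<Rightarrow> complex^'d \<Rightarrow> complex^'d \<Rightarrow> real set" where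
  "tangent_disc_sizes \<Omega> x v =
     {cmod c | c f. holomorphic_disc \<Omega> f \<and> f 0 = x \<and> c *s (\<chi> i. deriv (\<lambda>z. f z $ i) 0) = v}"

lemma kobayashi_metric_eq: "kobayashi_metric \<Omega> x v = Inf (tangent_disc_sizes \<Omega> x v)"
  by (simp add: kobayashi_metric_def tangent_disc_sizes_def)

lemma bdd_below_tangent_disc_sizes: "bdd_below (tangent_disc_sizes \<Omega> x v)"
  by (rule bdd_belowI[of _ 0]) (auto simp: tangent_disc_sizes_def)

lemma tangent_disc_sizes_nonempty:
  assumes "open \<Omega>" "x \<in> \<Omega>"
  shows "tangent_disc_sizes \<Omega> x v \<noteq> {}"
proof -
  obtain r where r: "0 < r" "ball x r \<subseteq> \<Omega>"
    using assms open_contains_ball by blast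
  \<comment> \<open>Scaling by \<open>s\<close> brings \<open>v\<close> into the ball of radius
    \<open>r\<close>; the \<open>+ 1\<close> covers \<open>v = 0\<close>.\<close>
  define s where "s = r / (norm v + 1)"
  have nv: "0 < norm v + 1" by (simp add: add_nonneg_pos)
  have "0 < s" using r(1) nv by (simp add: s_def)
  have "norm (complex_of_real s *s v) \<le> r"
  proof -
    have "norm (complex_of_real s *s v) = s * norm v"
      using \<open>0 < s\<close> by (simp add: norm_vector_scalar_mult)
    also have "\<dots> \<le> r" using r(1) nv by (simp add: s_def field_simps)
    finally show ?thesis .
  qed
  then have "holomorphic_disc \<Omega> (\<lambda>z. x + z *s (complex_of_real s *s v))"
    using holomorphic_disc_affine r by blast
  moreover have "(\<chi> i. deriv (\<lambda>z. (x + z *s (complex_of_real s *s v)) $ i) 0) = complex_of_real s *s v"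
  proof -
    have "deriv (\<lambda>z. x $ i + z * w) 0 = w" for i and w :: complex
      by (rule DERIV_imp_deriv) (auto intro!: derivative_eq_intros)
    then show ?thesis by (simp add: vec_eq_iff mult.assoc)
  qed
  moreover have "complex_of_real (1 / s) *s (complex_of_real s *s v) = v"
    using \<open>0 < s\<close> by (simp add: vector_smult_assoc)
  ultimately have "cmod (complex_of_real (1 / s)) \<in> tangent_disc_sizes \<Omega> x v"
    unfolding tangent_disc_sizes_def
    by (intro CollectI exI[of _ "complex_of_real (1 / s)"]
         exI[of _ "\<lambda>z. x + z *s (complex_of_real s *s v)"]) simp
  then show ?thesis by blast
qed

text \<open>Discs in a bounded set have bounded derivative at 0, so a long vector needs a large
  factor. This bounds the reciprocals whose supremum is \<open>goldilocks_M\<close>.\<close>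

lemma kobayashi_metric_lower_bound:
  fixes \<Omega> :: "(complex^'d) set"
  assumes "open \<Omega>" "bounded \<Omega>"
  obtains c where "0 < c" "\<And>x v. x \<in> \<Omega> \<Longrightarrow> c * norm v \<le> kobayashi_metric \<Omega> x v"
proof -
  obtain R where "0 < R" and R: "\<And>y. y \<in> \<Omega> \<Longrightarrow> norm y \<le> R"
    using assms(2) bounded_pos by metis
  define c where "c = 1 / (CARD('d) * (2 * R))"
  have "0 < real CARD('d) * (2 * R)" using \<open>0 < R\<close> by simp
  have "c * norm v \<le> kobayashi_metric \<Omega> x v" if "x \<in> \<Omega>" for x v
    unfolding kobayashi_metric_eq
  proof (rule cInf_greatest[OF tangent_disc_sizes_nonempty[OF assms(1) that]])
    fix s assume "s \<in> tangent_disc_sizes \<Omega> x v"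
    then obtain a f where s: "s = cmod a" "holomorphic_disc \<Omega> f" "a *s (\<chi> i. deriv (\<lambda>z. f z $ i) 0) = v"
      unfolding tangent_disc_sizes_def by blast
    have "norm v \<le> s * (CARD('d) * (2 * R))"
      using holomorphic_disc_deriv_bound[OF s(2) R]
      unfolding s(3)[symmetric] norm_vector_scalar_mult s(1) by (intro mult_left_mono) auto
    then show "c * norm v \<le> s"
      using \<open>0 < real CARD('d) * (2 * R)\<close> by (simp add: c_def divide_le_eq mult.commute)
  qed
  moreover have "0 < c" using \<open>0 < R\<close> by (simp add: c_def)
  ultimately show thesis using that by blast
qed

text \<open>One half of the homogeneity of the metric: dividing the coefficient of a disc by
  \<open>norm v\<close> makes it admissible for the unit vector.\<close>

lemma kobayashi_metric_normalize:
  assumes "open \<Omega>" "x \<in> \<Omega>" "v \<noteq> 0"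
  shows "norm v * kobayashi_metric \<Omega> x (complex_of_real (1 / norm v) *s v) \<le> kobayashi_metric \<Omega> x v"
  unfolding kobayashi_metric_eq[of \<Omega> x v]
proof (rule cInf_greatest[OF tangent_disc_sizes_nonempty[OF assms(1,2)]])
  fix s assume "s \<in> tangent_disc_sizes \<Omega> x v"
  then obtain a f where s: "s = cmod a" "holomorphic_disc \<Omega> f" "f 0 = x"
      "a *s (\<chi> i. deriv (\<lambda>z. f z $ i) 0) = v"
    unfolding tangent_disc_sizes_def by blast
  let ?b = "complex_of_real (1 / norm v) * a"
  have "?b *s (\<chi> i. deriv (\<lambda>z. f z $ i) 0) = complex_of_real (1 / norm v) *s v"
    unfolding s(4)[symmetric] by (simp only: vector_smult_assoc)
  then have "cmod ?b \<in> tangent_disc_sizes \<Omega> x (complex_of_real (1 / norm v) *s v)"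
    unfolding tangent_disc_sizes_def using s by blast
  then have "kobayashi_metric \<Omega> x (complex_of_real (1 / norm v) *s v) \<le> cmod ?b"
    unfolding kobayashi_metric_eq by (rule cInf_lower) (rule bdd_below_tangent_disc_sizes)
  also have "cmod ?b = s / norm v"
    by (simp add: norm_mult norm_divide s(1))
  finally show "norm v * kobayashi_metric \<Omega> x (complex_of_real (1 / norm v) *s v) \<le> s"
    using assms(3) by (simp add: field_simps)
qed

section \<open>The boundary distance and the function \<open>goldilocks_M\<close>\<close>

lemma bounded_domain_frontier_nonempty:
  assumes "bounded_domain \<Omega>" shows "frontier \<Omega> \<noteq> {}"
  using assms frontier_eq_empty[of \<Omega>] not_bounded_UNIV
  by (auto simp: bounded_domain_def)

lemma bdd_above_goldilocks_set:
  fixes \<Omega> :: "(complex^'d) set"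
  assumes "bounded_domain \<Omega>"
  shows "bdd_above {1 / kobayashi_metric \<Omega> x v | x v. x \<in> \<Omega> \<and> bdry_dist \<Omega> x \<le> r \<and> norm v = 1}"
proof -
  obtain c where c: "0 < c" "\<And>x v. x \<in> \<Omega> \<Longrightarrow> c * norm v \<le> kobayashi_metric \<Omega> x v"
    using kobayashi_metric_lower_bound[of \<Omega>] assms by (auto simp: bounded_domain_def)
  show ?thesis
  proof (rule bdd_aboveI[of _ "1 / c"], safe)
    fix x and v :: "complex^'d" assume "x \<in> \<Omega>" "norm v = 1"
    then show "1 / kobayashi_metric \<Omega> x v \<le> 1 / c"
      using c(1) c(2)[of x v] by (intro divide_left_mono) auto
  qed
qed

lemma goldilocks_M_upper:
  assumes "bounded_domain \<Omega>" "x \<in> \<Omega>" "bdry_dist \<Omega> x \<le> r" "norm v = 1"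
  shows "1 / kobayashi_metric \<Omega> x v \<le> goldilocks_M \<Omega> r"
  unfolding goldilocks_M_def
  by (rule cSup_upper[OF _ bdd_above_goldilocks_set[OF assms(1)]]) (use assms in auto)

lemma kobayashi_metric_nonneg:
  assumes "open \<Omega>" "x \<in> \<Omega>"
  shows "0 \<le> kobayashi_metric \<Omega> x v"
  unfolding kobayashi_metric_eq
  by (rule cInf_greatest[OF tangent_disc_sizes_nonempty[OF assms]]) (auto simp: tangent_disc_sizes_def)

lemma goldilocks_M_nonneg_of_point:
  fixes \<Omega> :: "(complex^'d) set"
  assumes "bounded_domain \<Omega>" "x \<in> \<Omega>" "bdry_dist \<Omega> x \<le> r"
  shows "0 \<le> goldilocks_M \<Omega> r"
proof -
  obtain v :: "complex^'d" where "norm v = 1"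
    by (meson vector_choose_size zero_le_one)
  have "0 \<le> 1 / kobayashi_metric \<Omega> x v"
    using assms by (auto simp: bounded_domain_def intro: kobayashi_metric_nonneg)
  also have "\<dots> \<le> goldilocks_M \<Omega> r"
    by (rule goldilocks_M_upper[OF assms \<open>norm v = 1\<close>])
  finally show ?thesis .
qed

text \<open>For each positive radius this makes the set under the supremum in
  \<open>goldilocks_M\<close> nonempty.\<close>

lemma bounded_domain_near_boundary:
  assumes "bounded_domain \<Omega>" "0 < r"
  obtains x where "x \<in> \<Omega>" "bdry_dist \<Omega> x \<le> r"
proof -
  obtain y where y: "y \<in> frontier \<Omega>" using bounded_domain_frontier_nonempty[OF assms(1)] by blast
  then have "y \<in> closure \<Omega>" by (simp add: frontier_def)
  then obtain x where "x \<in> \<Omega>" "dist x y < r"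
    using assms(2) closure_approachable by blast
  moreover have "bdry_dist \<Omega> x \<le> dist x y"
    unfolding bdry_dist_def using y by (rule infdist_le)
  ultimately show thesis using that by force
qed

lemma goldilocks_M_nonneg:
  assumes "bounded_domain \<Omega>" "0 < r"
  shows "0 \<le> goldilocks_M \<Omega> r"
  using bounded_domain_near_boundary[OF assms] goldilocks_M_nonneg_of_point[OF assms(1)] by metis

text \<open>The sets under the supremum grow with the radius. Positivity of \<open>r\<close> makes
  the smaller one nonempty, as the comparison of suprema requires.\<close>

lemma goldilocks_M_mono:
  fixes \<Omega> :: "(complex^'d) set"
  assumes "bounded_domain \<Omega>" "0 < r" "r \<le> r'"
  shows "goldilocks_M \<Omega> r \<le> goldilocks_M \<Omega> r'"
  unfolding goldilocks_M_def
proof (rule cSup_subset_mono[OF _ bdd_above_goldilocks_set[OF assms(1)]])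
  obtain x where x: "x \<in> \<Omega>" "bdry_dist \<Omega> x \<le> r"
    using bounded_domain_near_boundary[OF assms(1,2)] by blast
  obtain v :: "complex^'d" where "norm v = 1"
    by (meson vector_choose_size zero_le_one)
  then show "{1 / kobayashi_metric \<Omega> x v |x v. x \<in> \<Omega> \<and> bdry_dist \<Omega> x \<le> r \<and> norm v = 1} \<noteq> {}"
    using x by blast
qed (use assms(3) in force)

text \<open>Converts a bound on the Kobayashi speed of a curve near the boundary into one on its
  Euclidean speed.\<close>

lemma norm_le_goldilocks_M_times_metric:
  assumes dom: "bounded_domain \<Omega>" and x: "x \<in> \<Omega>" "bdry_dist \<Omega> x \<le> r"
  shows "norm v \<le> goldilocks_M \<Omega> r * kobayashi_metric \<Omega> x v"
proof (cases "v = 0")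
  case True
  have "open \<Omega>" using dom by (simp add: bounded_domain_def)
  then show ?thesis
    using True kobayashi_metric_nonneg[of \<Omega> x v] goldilocks_M_nonneg_of_point[OF dom x] x by simp
next
  case False
  define u where "u = complex_of_real (1 / norm v) *s v"
  have "open \<Omega>" "bounded \<Omega>" using dom by (auto simp: bounded_domain_def)
  have u: "norm u = 1"
    using False unfolding u_def norm_vector_scalar_mult by (simp only: norm_of_real) simp
  obtain c where "0 < c" "\<And>x v. x \<in> \<Omega> \<Longrightarrow> c * norm v \<le> kobayashi_metric \<Omega> x v"
    using kobayashi_metric_lower_bound[OF \<open>open \<Omega>\<close> \<open>bounded \<Omega>\<close>] by blast
  \<comment> \<open>Strict positivity is essential: with \<open>1 / 0 = 0\<close> the bound on the
    reciprocal would say nothing.\<close>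
  from this(1) this(2)[OF x(1), of u] have k: "0 < kobayashi_metric \<Omega> x u"
    unfolding u by simp
  have "1 \<le> goldilocks_M \<Omega> r * kobayashi_metric \<Omega> x u"
    using goldilocks_M_upper[OF dom x u] k by (simp add: divide_le_eq)
  then have "norm v * 1 \<le> norm v * (goldilocks_M \<Omega> r * kobayashi_metric \<Omega> x u)"
    by (intro mult_left_mono) auto
  also have "\<dots> = goldilocks_M \<Omega> r * (norm v * kobayashi_metric \<Omega> x u)" by simp
  also have "\<dots> \<le> goldilocks_M \<Omega> r * kobayashi_metric \<Omega> x v"
    unfolding u_def
    by (intro mult_left_mono kobayashi_metric_normalize goldilocks_M_nonneg_of_point[OF dom x])
       (use \<open>open \<Omega>\<close> x False in auto)
  finally show ?thesis by simp
qed

section \<open>Exponential tails under the Dini condition\<close>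

text \<open>For \<open>r = A * exp (c * t)\<close> one has \<open>dr / r = c * dt\<close>, so the
  weight \<open>1 / r\<close> becomes the constant \<open>\<bar>c\<bar>\<close>.\<close>

lemma has_integral_exp_substitution:
  fixes m :: "real \<Rightarrow> real"
  assumes S: "S \<in> sets lebesgue" and c: "c \<noteq> 0" and A: "0 < A"
    and img: "(\<lambda>t. A * exp (c * t)) ` S = {0<..<a}"
    and int: "(\<lambda>r. m r / r) absolutely_integrable_on {0<..<a}"
  shows "((\<lambda>t. m (A * exp (c * t))) has_integral integral {0<..<a} (\<lambda>r. m r / r) / \<bar>c\<bar>) S"
proof -
  let ?g = "\<lambda>t. A * exp (c * t)"
  have inj: "inj_on ?g S"
    using A c by (auto simp: inj_on_def)
  have der: "(?g has_field_derivative A * exp (c * t) * c) (at t within S)" for t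
    by (auto intro!: derivative_eq_intros)
  have "(\<lambda>t. \<bar>A * exp (c * t) * c\<bar> * (m (?g t) / ?g t)) absolutely_integrable_on S \<and>
      integral S (\<lambda>t. \<bar>A * exp (c * t) * c\<bar> * (m (?g t) / ?g t)) = integral {0<..<a} (\<lambda>r. m r / r)"
    using has_absolute_integral_change_of_variables_1'[OF S der inj, of "\<lambda>r. m r / r"] img int by auto
  moreover have "\<bar>A * exp (c * t) * c\<bar> * (m (?g t) / ?g t) = \<bar>c\<bar> * m (?g t)" for t
    using A by (simp add: abs_mult)
  ultimately have "((\<lambda>t. \<bar>c\<bar> * m (?g t)) has_integral integral {0<..<a} (\<lambda>r. m r / r)) S"
    using set_lebesgue_integral_eq_integral(1) by (metis (no_types, lifting) ext has_integral_integral)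
  then have "((\<lambda>t. (1 / \<bar>c\<bar>) * (\<bar>c\<bar> * m (?g t))) has_integral
      (1 / \<bar>c\<bar>) * integral {0<..<a} (\<lambda>r. m r / r)) S"
    by (rule has_integral_mult_right)
  then show ?thesis using c by simp
qed

lemma exp_image_greaterThan:
  fixes A c :: real
  assumes "0 < A" "c < 0"
  shows "(\<lambda>t. A * exp (c * t)) ` {s<..} = {0<..<A * exp (c * s)}"
proof (intro equalityI subsetI)
  fix y assume y: "y \<in> {0<..<A * exp (c * s)}"
  then have "y / A < exp (c * s)" "0 < y / A"
    using assms by (auto simp: field_simps)
  then have "ln (y / A) < c * s"
    by (metis ln_exp ln_less_cancel_iff exp_gt_zero)
  then have "s < ln (y / A) / c"
    using assms(2) by (simp add: field_simps)
  moreover have "y = A * exp (c * (ln (y / A) / c))"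
    using y assms by simp
  ultimately show "y \<in> (\<lambda>t. A * exp (c * t)) ` {s<..}" by blast
qed (use assms in auto)

text \<open>The reflection of \<open>t\<close> reduces this to the decreasing exponential.\<close>

lemma exp_image_lessThan:
  fixes A c :: real
  assumes "0 < A" "0 < c"
  shows "(\<lambda>t. A * exp (c * t)) ` {..<s} = {0<..<A * exp (c * s)}"
proof -
  have "(\<lambda>t. A * exp (c * t)) ` {..<s} = (\<lambda>t. A * exp (c * t)) ` (uminus ` {-s<..})"
    by simp
  also have "\<dots> = (\<lambda>t. A * exp (- c * t)) ` {-s<..}"
    by (simp only: image_image mult_minus_right mult_minus_left)
  finally show ?thesis using exp_image_greaterThan[of A "-c" "-s"] assms by simp
qed

text \<open>The function \<open>h\<close> equals \<open>m \<epsilon>\<close> on a fixed interval around \<open>t0\<close>, chosen so long that the tails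
  are small; then \<open>\<epsilon>\<close> is chosen, using \<open>m \<epsilon> \<rightarrow> 0\<close>, which the Dini condition forces.\<close>

lemma dini_exponential_integral_small:
  fixes m :: "real \<Rightarrow> real"
  assumes nonneg: "\<And>r. 0 < r \<Longrightarrow> 0 \<le> m r"
    and mono: "\<And>r r'. 0 < r \<Longrightarrow> r \<le> r' \<Longrightarrow> m r \<le> m r'"
    and dini: "0 < \<rho>" "(\<integral>\<^sup>+ r\<in>{0<..<\<rho>}. ennreal (1 / r * m r) \<partial>lborel) < \<infinity>"
    and pos: "0 < A" "0 < B" "0 < \<eta>"
  obtains \<epsilon> where "0 < \<epsilon>"
    "\<And>t0. \<exists>h I. (h has_integral I) UNIV \<and> I \<le> \<eta> \<and>
        (\<forall>t. h t = m \<epsilon> \<or> h t = m (A * exp (- B * \<bar>t - t0\<bar>)))"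
proof -
  define w where "w r = m r / r" for r
  define J where "J a = integral {0..a} w" for a
  have w0: "0 \<le> w r" if "0 < r" for r using nonneg[OF that] that by (simp add: w_def)
  \<comment> \<open>Measurability comes from monotonicity, which is known only on the positive
    reals; hence the restriction and the indicator.\<close>
  have "mono_on {0<..} m" using mono by (auto simp: mono_on_def)
  then have "m \<in> borel_measurable (restrict_space borel {0<..})"
    by (rule borel_measurable_mono_on_fnc)
  then have meas: "(\<lambda>r. indicator {0<..} r *\<^sub>R m r) \<in> borel_measurable borel"
    by (subst (asm) borel_measurable_restrict_space_iff) auto
  have "set_integrable lborel {0<..<\<rho>} w"
    unfolding set_integrable_def
  proof (rule integrableI_nonneg)
    have "(\<lambda>r. indicator {0<..<\<rho>} r *\<^sub>R w r)
        = (\<lambda>r. indicator {0<..<\<rho>} r * (indicator {0<..} r *\<^sub>R m r) / r)"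
      by (auto simp: w_def indicator_def)
    then show "(\<lambda>r. indicator {0<..<\<rho>} r *\<^sub>R w r) \<in> borel_measurable lborel"
      using meas by simp
    show "AE r in lborel. 0 \<le> indicator {0<..<\<rho>} r *\<^sub>R w r"
      using w0 by (auto simp: indicator_def)
    have "(\<integral>\<^sup>+ r. ennreal (indicator {0<..<\<rho>} r *\<^sub>R w r) \<partial>lborel)
        = (\<integral>\<^sup>+ r\<in>{0<..<\<rho>}. ennreal (1 / r * m r) \<partial>lborel)"
      by (intro nn_integral_cong) (auto simp: w_def indicator_def)
    then show "(\<integral>\<^sup>+ r. ennreal (indicator {0<..<\<rho>} r *\<^sub>R w r) \<partial>lborel) < \<infinity>"
      using dini(2) by simp
  qed
  then have intw: "w integrable_on {0..\<rho>}"
    using set_borel_integral_eq_integral(1) integrable_on_Icc_iff_Ioo by blast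
  have intw': "w integrable_on {a..b}" if "0 \<le> a" "b \<le> \<rho>" for a b
    using integrable_on_subinterval[OF intw] that by auto
  have absw: "w absolutely_integrable_on {0<..<a}" if "a \<le> \<rho>" for a
    using intw'[of 0 a] that w0 integrable_on_Icc_iff_Ioo
    by (intro nonnegative_absolutely_integrable_1) auto
  have "continuous_on {0..\<rho>} J"
    unfolding J_def using indefinite_integral_continuous_1[OF intw] .
  \<comment> \<open>By continuity of the indefinite integral at 0. The extra bound \<open>b\<close>
    lets a caller keep \<open>a\<close> below a prescribed value.\<close>
  have Jsmall: "\<exists>a>0. a \<le> \<rho> \<and> a \<le> b \<and> J a \<le> e" if "0 < e" "0 < b" for e b
  proof -
    have "J 0 = 0" by (simp add: J_def)
    obtain d where d: "0 < d" "\<And>x. x \<in> {0..\<rho>} \<Longrightarrow> dist x 0 < d \<Longrightarrow> dist (J x) (J 0) < e"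
      using \<open>continuous_on {0..\<rho>} J\<close> \<open>0 < e\<close> dini(1) unfolding continuous_on_iff
      by (metis atLeastAtMost_iff less_imp_le order_refl)
    define a where "a = min (min \<rho> b) (d / 2)"
    have "0 < a" "a \<le> \<rho>" "a \<le> b" "a < d" using d(1) that dini(1) by (auto simp: a_def)
    then have "dist (J a) (J 0) < e" by (intro d(2)) auto
    then have "J a \<le> e" using \<open>J 0 = 0\<close> by (simp add: dist_real_def)
    then show ?thesis using \<open>0 < a\<close> \<open>a \<le> \<rho>\<close> \<open>a \<le> b\<close> by blast
  qed
  \<comment> \<open>On \<open>{r..2 * r}\<close> the integrand is at least
    \<open>m r / (2 * r)\<close>, so that this interval alone contributes \<open>m r / 2\<close>.
    This is how integrability forces \<open>m\<close> to be small near 0.\<close>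
  have mJ: "m r \<le> 2 * J (2 * r)" if "0 < r" "2 * r \<le> \<rho>" for r
  proof -
    have "r * (m r / (2 * r)) = integral {r..2 * r} (\<lambda>_. m r / (2 * r))"
      using that by simp
    also have "\<dots> \<le> integral {r..2 * r} w"
    proof (rule integral_le)
      show "m r / (2 * r) \<le> w x" if "x \<in> {r..2 * r}" for x
        unfolding w_def using that \<open>0 < r\<close> nonneg[of r] nonneg[of x] mono[of r x]
        by (intro frac_le) auto
    qed (use that intw' in auto)
    also have "\<dots> \<le> J (2 * r)"
    proof -
      have "integral {0..r} w + integral {r..2 * r} w = J (2 * r)"
        unfolding J_def using that intw'[of 0 "2 * r"] by (intro Henstock_Kurzweil_Integration.integral_combine) auto
      \<comment> \<open>The sign of \<open>w\<close> is recorded at positive points only, so the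
        open interval is used; its integral is the same.\<close>
      moreover have "0 \<le> integral {0<..<r} w"
        using w0 by (intro integral_nonneg) (use absw[of r] that set_lebesgue_integral_eq_integral(1) in auto)
      ultimately show ?thesis by (simp add: integral_open_interval_real)
    qed
    finally show ?thesis using that by simp
  qed
  have "0 < B * \<eta> / 4" using pos by simp
  \<comment> \<open>Each of the two tails will integrate to \<open>J a / B\<close>, at most a
    quarter of \<eta>. Keeping \<open>a\<close> below \<open>A\<close> makes the half-length
    \<open>s\<close> of the middle interval nonnegative.\<close>
  then obtain a where a: "0 < a" "a \<le> \<rho>" "a \<le> A" "J a \<le> B * \<eta> / 4"
    using Jsmall[of "B * \<eta> / 4" A] pos by blast
  define s where "s = ln (A / a) / B"
  have "0 \<le> s" using a pos by (simp add: s_def)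
  have s: "A * exp (- B * s) = a" using a pos by (simp add: s_def exp_minus)
  \<comment> \<open>The middle interval has length \<open>2 * s\<close>, and with the factor 2 of
    \<open>mJ\<close> this choice leaves it at most half of \<eta>. Using \<open>s + 1\<close>
    covers \<open>s = 0\<close>.\<close>
  have "0 < \<eta> / (8 * (s + 1))" using pos \<open>0 \<le> s\<close> by simp
  then obtain b where b: "0 < b" "b \<le> \<rho>" "J b \<le> \<eta> / (8 * (s + 1))"
    using Jsmall[of _ \<rho>] dini(1) by blast
  define \<epsilon> where "\<epsilon> = b / 2"
  have "0 < \<epsilon>" using b by (simp add: \<epsilon>_def)
  have "m \<epsilon> \<le> 2 * J b" using mJ[of \<epsilon>] b by (simp add: \<epsilon>_def)
  also have "\<dots> \<le> 2 * (\<eta> / (8 * (s + 1)))" using b(3) by simp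
  finally have "m \<epsilon> * (4 * (s + 1)) \<le> \<eta>"
    using \<open>0 \<le> s\<close> by (simp add: field_simps)
  moreover have "m \<epsilon> * (4 * s) \<le> m \<epsilon> * (4 * (s + 1))"
    using nonneg[OF \<open>0 < \<epsilon>\<close>] by (intro mult_left_mono) auto
  ultimately have "m \<epsilon> * (4 * s) \<le> \<eta>" by linarith
  then have m\<epsilon>: "2 * s * m \<epsilon> \<le> \<eta> / 2" by (simp add: mult_ac)
  show thesis
  proof (rule that[OF \<open>0 < \<epsilon>\<close>])
    fix t0 :: real
    \<comment> \<open>Middle interval, right tail and left tail. On each tail the sign of
      \<open>t - t0\<close> is fixed, so the exponential splits into a constant depending on
      \<open>t0\<close> and a pure exponential in \<open>t\<close>; the resulting integral does not
      depend on \<open>t0\<close>.\<close>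
    define h1 where "h1 t = (if t \<in> {t0 - s..t0 + s} then m \<epsilon> else 0)" for t
    define h2 where "h2 t = (if t \<in> {t0 + s<..} then m (A * exp (B * t0) * exp (- B * t)) else 0)" for t
    define h3 where "h3 t = (if t \<in> {..<t0 - s} then m (A * exp (- B * t0) * exp (B * t)) else 0)" for t
    have "((\<lambda>t. m \<epsilon>) has_integral 2 * s * m \<epsilon>) {t0 - s..t0 + s}"
      using has_integral_const_real[of "m \<epsilon>" "t0 - s" "t0 + s"] \<open>0 \<le> s\<close> by simp
    then have 1: "(h1 has_integral 2 * s * m \<epsilon>) UNIV"
      unfolding h1_def by (subst has_integral_restrict_UNIV)
    have "A * exp (B * t0) * exp (- B * (t0 + s)) = a" "A * exp (- B * t0) * exp (B * (t0 - s)) = a"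
      unfolding s[symmetric] by (simp_all add: field_simps flip: exp_add)
    then have "(\<lambda>t. A * exp (B * t0) * exp (- B * t)) ` {t0 + s<..} = {0<..<a}"
      "(\<lambda>t. A * exp (- B * t0) * exp (B * t)) ` {..<t0 - s} = {0<..<a}"
      using exp_image_greaterThan[of "A * exp (B * t0)" "- B" "t0 + s"]
        exp_image_lessThan[of "A * exp (- B * t0)" B "t0 - s"] pos by auto
    then have "((\<lambda>t. m (A * exp (B * t0) * exp (- B * t))) has_integral J a / B) {t0 + s<..}"
      "((\<lambda>t. m (A * exp (- B * t0) * exp (B * t))) has_integral J a / B) {..<t0 - s}"
      using has_integral_exp_substitution[of "{t0 + s<..}" "- B" "A * exp (B * t0)" a m]
        has_integral_exp_substitution[of "{..<t0 - s}" B "A * exp (- B * t0)" a m]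
        pos absw[OF a(2)] by (simp_all add: J_def integral_open_interval_real w_def[abs_def])
    then have 2: "(h2 has_integral J a / B) UNIV" and 3: "(h3 has_integral J a / B) UNIV"
      unfolding h2_def h3_def by (simp_all only: has_integral_restrict_UNIV)
    have "((\<lambda>t. h1 t + h2 t + h3 t) has_integral 2 * s * m \<epsilon> + J a / B + J a / B) UNIV"
      by (intro has_integral_add 1 2 3)
    moreover have "J a / B \<le> \<eta> / 4"
      using a(4) pos by (simp add: field_simps)
    then have "2 * s * m \<epsilon> + J a / B + J a / B \<le> \<eta>"
      using m\<epsilon> by linarith
    moreover have "h1 t + h2 t + h3 t = m \<epsilon> \<or> h1 t + h2 t + h3 t = m (A * exp (- B * \<bar>t - t0\<bar>))" for t
    proof -
      consider "t < t0 - s" | "t \<in> {t0 - s..t0 + s}" | "t0 + s < t" by fastforce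
      then show ?thesis
      proof cases
        case 1
        have e: "A * exp (- B * t0) * exp (B * t) = A * exp (- B * \<bar>t - t0\<bar>)"
          using 1 \<open>0 \<le> s\<close> by (simp add: field_simps flip: exp_add)
        have "h1 t = 0" "h2 t = 0" "h3 t = m (A * exp (- B * t0) * exp (B * t))"
          using 1 \<open>0 \<le> s\<close> by (simp_all add: h1_def h2_def h3_def)
        then show ?thesis unfolding e by simp
      next
        case 2
        then show ?thesis by (auto simp: h1_def h2_def h3_def)
      next
        case 3
        have e: "A * exp (B * t0) * exp (- B * t) = A * exp (- B * \<bar>t - t0\<bar>)"
          using 3 \<open>0 \<le> s\<close> by (simp add: field_simps flip: exp_add)
        have "h1 t = 0" "h3 t = 0" "h2 t = m (A * exp (B * t0) * exp (- B * t))"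
          using 3 \<open>0 \<le> s\<close> by (simp_all add: h1_def h2_def h3_def)
        then show ?thesis unfolding e by simp
      qed
    qed
    ultimately show "\<exists>h I. (h has_integral I) UNIV \<and> I \<le> \<eta> \<and>
        (\<forall>t. h t = m \<epsilon> \<or> h t = m (A * exp (- B * \<bar>t - t0\<bar>)))"
      by blast
  qed
qed

section \<open>Almost-geodesics near the boundary\<close>

text \<open>The frontier has to be nonempty here, since \<open>infdist\<close> to the empty set is
  0.\<close>

lemma bdry_dist_pos:
  assumes "bounded_domain \<Omega>" "x \<in> \<Omega>"
  shows "0 < bdry_dist \<Omega> x"
proof -
  have "x \<notin> frontier \<Omega>"
    using assms by (auto simp: bounded_domain_def frontier_def interior_open)
  then show ?thesis
    unfolding bdry_dist_def
    using bounded_domain_frontier_nonempty[OF assms(1)] by (simp add: infdist_pos_not_in_closed)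
qed

text \<open>Supplies the compact set of the theorem: the distance condition is closed and excludes
  the frontier, where the distance vanishes.\<close>

lemma compact_bdry_dist_ge:
  assumes "bounded_domain \<Omega>" "0 < \<epsilon>"
  shows "compact {x \<in> closure \<Omega>. \<epsilon> \<le> bdry_dist \<Omega> x}"
    and "{x \<in> closure \<Omega>. \<epsilon> \<le> bdry_dist \<Omega> x} \<subseteq> \<Omega>"
proof -
  have "closed {x. \<epsilon> \<le> bdry_dist \<Omega> x}"
    unfolding bdry_dist_def by (intro closed_Collect_le continuous_intros)
  moreover have "compact (closure \<Omega>)"
    using assms(1) by (simp add: bounded_domain_def compact_closure)
  ultimately show "compact {x \<in> closure \<Omega>. \<epsilon> \<le> bdry_dist \<Omega> x}"
    by (simp add: Collect_conj_eq compact_Int_closed)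
  show "{x \<in> closure \<Omega>. \<epsilon> \<le> bdry_dist \<Omega> x} \<subseteq> \<Omega>"
  proof safe
    fix x assume x: "x \<in> closure \<Omega>" "\<epsilon> \<le> bdry_dist \<Omega> x"
    then have "x \<notin> frontier \<Omega>"
      using assms(2) by (auto simp: bdry_dist_def)
    then show "x \<in> \<Omega>"
      using x(1) interior_subset by (auto simp: frontier_def)
  qed
qed

text \<open>Both legs through \<open>x0\<close> contribute \<open>C\<close>, and the logarithm at
  \<open>t0\<close> is absorbed into the one at \<open>t\<close>, which is at least as large; hence
  \<open>2 * C\<close> and \<open>2 * \<alpha>\<close>.\<close>

lemma almost_geodesic_bdry_dist_decay:
  assumes dom: "bounded_domain \<Omega>" and \<sigma>: "almost_geodesic \<Omega> \<Lambda> \<kappa> S \<sigma>" and "\<Lambda> \<ge> 1" "0 < \<alpha>"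
    and x0: "x0 \<in> \<Omega>" "\<And>x. x \<in> \<Omega> \<Longrightarrow> kobayashi_dist \<Omega> x0 x \<le> C + \<alpha> * ln (1 / bdry_dist \<Omega> x)"
    and t: "t0 \<in> S" "t \<in> S" "bdry_dist \<Omega> (\<sigma> t) \<le> bdry_dist \<Omega> (\<sigma> t0)"
  shows "bdry_dist \<Omega> (\<sigma> t) \<le> exp ((2 * C + \<kappa>) / (2 * \<alpha>)) * exp (- (1 / (2 * \<alpha> * \<Lambda>)) * \<bar>t - t0\<bar>)"
proof -
  have in\<Omega>: "\<sigma> t0 \<in> \<Omega>" "\<sigma> t \<in> \<Omega>"
    using \<sigma> t by (auto simp: almost_geodesic_def)
  let ?f = "bdry_dist \<Omega> (\<sigma> t0)" and ?e = "bdry_dist \<Omega> (\<sigma> t)"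
  have pos: "0 < ?e" "0 < ?f" using bdry_dist_pos[OF dom] in\<Omega> by auto
  have "\<bar>t - t0\<bar> / \<Lambda> - \<kappa> \<le> kobayashi_dist \<Omega> (\<sigma> t0) (\<sigma> t)"
    using \<sigma> t by (auto simp: almost_geodesic_def)
  also have "\<dots> \<le> kobayashi_dist \<Omega> (\<sigma> t0) x0 + kobayashi_dist \<Omega> x0 (\<sigma> t)"
    using dom in\<Omega> x0(1) by (intro kobayashi_dist_triangle) (auto simp: bounded_domain_def)
  also have "\<dots> \<le> 2 * C + \<alpha> * ln (1 / ?f) + \<alpha> * ln (1 / ?e)"
    using x0(2)[OF in\<Omega>(1)] x0(2)[OF in\<Omega>(2)] kobayashi_dist_commute[of \<Omega> "\<sigma> t0" x0] by linarith
  also have "\<alpha> * ln (1 / ?f) \<le> \<alpha> * ln (1 / ?e)"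
    using pos t(3) \<open>0 < \<alpha>\<close> by (intro mult_left_mono) (auto simp: ln_div)
  finally have "\<bar>t - t0\<bar> / \<Lambda> - \<kappa> \<le> 2 * C - 2 * \<alpha> * ln ?e"
    using pos by (simp add: ln_div)
  then have "2 * \<alpha> * ln ?e \<le> 2 * C + \<kappa> - \<bar>t - t0\<bar> / \<Lambda>" by linarith
  then have "ln ?e \<le> (2 * C + \<kappa> - \<bar>t - t0\<bar> / \<Lambda>) / (2 * \<alpha>)"
    using \<open>0 < \<alpha>\<close> by (simp add: le_divide_eq mult.commute)
  also have "\<dots> = (2 * C + \<kappa>) / (2 * \<alpha>) + - (1 / (2 * \<alpha> * \<Lambda>)) * \<bar>t - t0\<bar>"
    using \<open>0 < \<alpha>\<close> \<open>\<Lambda> \<ge> 1\<close> by (simp add: field_simps)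
  finally show ?thesis
    using pos(1) by (metis exp_add exp_le_cancel_iff exp_ln)
qed

theorem theorem1p4:
  fixes \<Omega> :: "(complex^'d) set" and \<Lambda> \<kappa> :: real
    and \<xi> \<eta> :: "complex^'d" and V\<^sub>\<xi> V\<^sub>\<eta> :: "(complex^'d) set"
  assumes "goldilocks_domain \<Omega>"
    and "\<Lambda> \<ge> 1" and "\<kappa> \<ge> 0"
    and "\<xi> \<in> frontier \<Omega>" and "\<eta> \<in> frontier \<Omega>"
    and "nbhd_within (closure \<Omega>) \<xi> V\<^sub>\<xi>" and "nbhd_within (closure \<Omega>) \<eta> V\<^sub>\<eta>"
    and "closure V\<^sub>\<xi> \<inter> closure V\<^sub>\<eta> = {}"
  shows "\<exists>K. compact K \<and> K \<subseteq> \<Omega> \<and>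
           (\<forall>T \<sigma>. 0 \<le> T \<and> almost_geodesic \<Omega> \<Lambda> \<kappa> {0..T} \<sigma> \<and> \<sigma> 0 \<in> V\<^sub>\<xi> \<and> \<sigma> T \<in> V\<^sub>\<eta>
                  \<longrightarrow> \<sigma> ` {0..T} \<inter> K \<noteq> {})"
proof -
  have dom: "bounded_domain \<Omega>" using assms(1) by (simp add: goldilocks_domain_def)
  obtain \<rho> where \<rho>: "0 < \<rho>"
      "(\<integral>\<^sup>+ r\<in>{0<..<\<rho>}. ennreal (1 / r * goldilocks_M \<Omega> r) \<partial>lborel) < \<infinity>"
    using assms(1) by (auto simp: goldilocks_domain_def)
  obtain x0 where x0: "x0 \<in> \<Omega>" using dom by (auto simp: bounded_domain_def)
  obtain C \<alpha> where "0 < \<alpha>"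
      and C: "\<And>x. x \<in> \<Omega> \<Longrightarrow> kobayashi_dist \<Omega> x0 x \<le> C + \<alpha> * ln (1 / bdry_dist \<Omega> x)"
    using assms(1) x0 unfolding goldilocks_domain_def by blast
  \<comment> \<open>One of two disjoint closed sets is compact, so they lie at a positive
    distance.\<close>
  have "V\<^sub>\<xi> \<subseteq> closure \<Omega>" using assms(6) by (simp add: nbhd_within_def)
  then have "bounded V\<^sub>\<xi>"
    using dom bounded_closure bounded_subset by (auto simp: bounded_domain_def)
  then have "compact (closure V\<^sub>\<xi>)" by (simp add: compact_closure)
  then obtain d where "0 < d" and d: "\<And>x y. x \<in> V\<^sub>\<xi> \<Longrightarrow> y \<in> V\<^sub>\<eta> \<Longrightarrow> d \<le> dist x y"
    using separate_compact_closed[of "closure V\<^sub>\<xi>" "closure V\<^sub>\<eta>"] assms(8) closure_subset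
    by (metis closed_closure subsetD)
  let ?M = "goldilocks_M \<Omega>"
  let ?A = "exp ((2 * C + \<kappa>) / (2 * \<alpha>))" and ?B = "1 / (2 * \<alpha> * \<Lambda>)"
  \<comment> \<open>The displacement of the curve will be at most \<open>\<Lambda>\<close> times the
    integral of \<open>h\<close>, so this target keeps it within \<open>d / 2\<close>.\<close>
  have "0 < ?B" "0 < d / (2 * \<Lambda>)" using \<open>0 < \<alpha>\<close> \<open>0 < d\<close> \<open>\<Lambda> \<ge> 1\<close> by auto
  obtain \<epsilon> where "0 < \<epsilon>" and \<epsilon>: "\<And>t0. \<exists>h I. (h has_integral I) UNIV \<and> I \<le> d / (2 * \<Lambda>) \<and>
        (\<forall>t. h t = ?M \<epsilon> \<or> h t = ?M (?A * exp (- ?B * \<bar>t - t0\<bar>)))"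
    by (rule dini_exponential_integral_small[of ?M, OF goldilocks_M_nonneg[OF dom]
          goldilocks_M_mono[OF dom] \<rho> exp_gt_zero \<open>0 < ?B\<close> \<open>0 < d / (2 * \<Lambda>)\<close>]) auto
  \<comment> \<open>The value \<epsilon> was fixed before any curve was considered, so the same set
    serves all of them.\<close>
  let ?K = "{x \<in> closure \<Omega>. \<epsilon> \<le> bdry_dist \<Omega> x}"
  show ?thesis
  proof (intro exI[of _ ?K] conjI allI impI)
    show "compact ?K" "?K \<subseteq> \<Omega>"
      using compact_bdry_dist_ge[OF dom \<open>0 < \<epsilon>\<close>] by blast+
    fix T \<sigma>
    assume "0 \<le> T \<and> almost_geodesic \<Omega> \<Lambda> \<kappa> {0..T} \<sigma> \<and> \<sigma> 0 \<in> V\<^sub>\<xi> \<and> \<sigma> T \<in> V\<^sub>\<eta>"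
    then have "0 \<le> T" and geo: "almost_geodesic \<Omega> \<Lambda> \<kappa> {0..T} \<sigma>"
      and ends: "\<sigma> 0 \<in> V\<^sub>\<xi>" "\<sigma> T \<in> V\<^sub>\<eta>"
      by auto
    have in\<Omega>: "\<sigma> t \<in> \<Omega>" if "t \<in> {0..T}" for t
      using geo that by (auto simp: almost_geodesic_def)
    have ac: "absolutely_continuous_on {0..T} \<sigma>"
      using geo by (simp add: almost_geodesic_def)
    show "\<sigma> ` {0..T} \<inter> ?K \<noteq> {}"
    proof
      assume "\<sigma> ` {0..T} \<inter> ?K = {}"
      then have small: "bdry_dist \<Omega> (\<sigma> t) \<le> \<epsilon>" if "t \<in> {0..T}" for t
        using that in\<Omega>[OF that] closure_subset[of \<Omega>] by force
      have "continuous_on {0..T} (\<lambda>t. bdry_dist \<Omega> (\<sigma> t))"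
        unfolding bdry_dist_def
        by (intro continuous_intros absolutely_continuous_on_imp_continuous_on[OF ac])
      then obtain t0 where t0: "t0 \<in> {0..T}"
          and t0_max: "\<And>t. t \<in> {0..T} \<Longrightarrow> bdry_dist \<Omega> (\<sigma> t) \<le> bdry_dist \<Omega> (\<sigma> t0)"
        using continuous_attains_sup[of "{0..T}" "\<lambda>t. bdry_dist \<Omega> (\<sigma> t)"] \<open>0 \<le> T\<close> by auto
      obtain h I where h: "(h has_integral I) UNIV" "I \<le> d / (2 * \<Lambda>)"
          and h_eq: "\<And>t. h t = ?M \<epsilon> \<or> h t = ?M (?A * exp (- ?B * \<bar>t - t0\<bar>))"
        using \<epsilon>[of t0] by blast
      have h0: "0 \<le> h t" for t
        using h_eq[of t] goldilocks_M_nonneg[OF dom] \<open>0 < \<epsilon>\<close> by (metis exp_gt_zero mult_pos_pos)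
      have speed: "norm v \<le> \<Lambda> * h t" if t: "t \<in> {0..T}" and v: "kobayashi_metric \<Omega> (\<sigma> t) v \<le> \<Lambda>" for t v
      proof -
        have "bdry_dist \<Omega> (\<sigma> t) \<le> ?A * exp (- ?B * \<bar>t - t0\<bar>)"
          using almost_geodesic_bdry_dist_decay[OF dom geo \<open>\<Lambda> \<ge> 1\<close> \<open>0 < \<alpha>\<close> x0 C t0 t t0_max[OF t]] .
        \<comment> \<open>Both \<epsilon> and the exponential bound dominate
          \<open>bdry_dist \<Omega> (\<sigma> t)\<close>, so the estimate holds whichever of the two
          values \<open>h t\<close> takes.\<close>
        then have "norm v \<le> h t * kobayashi_metric \<Omega> (\<sigma> t) v"
          using h_eq[of t] norm_le_goldilocks_M_times_metric[OF dom in\<Omega>[OF t]] small[OF t] by metis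
        also have "\<dots> \<le> h t * \<Lambda>"
          using v h0 by (intro mult_left_mono) auto
        finally show ?thesis by (simp add: mult.commute)
      qed
      have "h integrable_on {0..T}"
        using h(1) integrable_on_subcbox[of h UNIV 0 T] by (auto simp: has_integral_integrable)
      then have "((\<lambda>t. \<Lambda> * h t) has_integral \<Lambda> * integral {0..T} h) {0..T}"
        by (intro has_integral_mult_right) (simp add: has_integral_integral)
      then have "dist (\<sigma> 0) (\<sigma> T) \<le> \<Lambda> * integral {0..T} h"
      proof (rule absolutely_continuous_on_dist_le_integral[OF ac \<open>0 \<le> T\<close>, rotated])
        have "AE t in lborel. t \<in> {0..T} \<longrightarrow>
            (\<exists>v. (\<sigma> has_vector_derivative v) (at t within {0..T}) \<and> kobayashi_metric \<Omega> (\<sigma> t) v \<le> \<Lambda>)"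
          using geo by (simp add: almost_geodesic_def)
        then show "AE t in lborel. t \<in> {0..T} \<longrightarrow>
            (\<exists>v. (\<sigma> has_vector_derivative v) (at t within {0..T}) \<and> norm v \<le> \<Lambda> * h t)"
          by (rule eventually_mono) (use speed in blast)
      qed (use h0 \<open>\<Lambda> \<ge> 1\<close> in auto)
      \<comment> \<open>Passing to the whole line removes the dependence on
        \<open>T\<close>.\<close>
      also have "integral {0..T} h \<le> integral UNIV h"
        using h(1) h0 \<open>h integrable_on {0..T}\<close> by (intro integral_subset_le) auto
      also have "integral UNIV h \<le> d / (2 * \<Lambda>)"
        using h by (simp add: integral_unique)
      finally have "dist (\<sigma> 0) (\<sigma> T) \<le> d / 2"
        using \<open>\<Lambda> \<ge> 1\<close> by (simp add: mult_left_mono)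
      then show False
        using d[OF ends] \<open>0 < d\<close> by linarith
    qed
  qed
qed

end
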